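(* Let $X$ be a free Poisson random measure (with $\alpha=1$) in a $W^*$-probability space $(\mathcal{A},\varphi)$. Let $f_n$ $(n\ge1)$ and $f$ be real-valued functions in $L^1(\mathbb{R})\cap L^2(\mathbb{R})$ such that $\lim_{n\to\infty}(\|f_n-f\|_1+\|f_n-f\|_2)=0$. Then $\lim_{n\to\infty}\|X(f_n)-X(f)\|_2=0$, that is, $$\lim_{n\to\infty}\int_{\mathbb{R}}f_n(t)\,X(dt)=\int_{\mathbb{R}}\lim_{n\to\infty}f_n(t)\,X(dt)$$ in $L^2(\mathcal{A},\varphi)$ (where $\lim_n f_n=f$ is the limit in $L^1(\mathbb{R})\cap L^2(\mathbb{R})$).
   Context: A $W^*$-probability space $(\mathcal{A},\varphi)$ is a finite von Neumann algebra with a faithful normal tracial state; $\|a\|_p=\varphi(|a|^p)^{1/p}$ and $L^p(\mathcal{A},\varphi)$ is the completion of $\mathcal{A}$ in $\|\cdot\|_p$, $p\ge1$. $\kappa_n(a):=\kappa_n(a,\dots,a)$ denotes the usual $n$-th free cumulant. Free Poisson random measure (with $\alpha=1$): a map $E\mapsto X_E$ from the set $\mathcal{B}_0$ of Borel subsets of $\mathbb{R}$ of finite Lebesgue measure $|E|$ into the self-adjoint elements of $\mathcal{A}$ such that (1) $\kappa_n(X_E)=|E|$ for all $n\ge1$; (2) if $E_1,\dots,E_k$ are mutually disjoint, then $X_{E_1},\dots,X_{E_k}$ are freely independent; (3) if $E_1,\dots,E_k$ are mutually disjoint, then $X_{\cup_{i=1}^kE_i}=\sum_{i=1}^kX_{E_i}$.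 Integral: for a simple function $s=\sum_{i=1}^nc_i\chi_{E_i}$ with $E_i\in\mathcal{B}_0$ mutually disjoint, $X(s)=\sum_{i=1}^nc_iX_{E_i}$. For $f\in L^2(\mathbb{R})$ whose support $S_f$ has finite measure, $X(f)=\int_{\mathbb{R}}f(x)X(dx)$ is the $\|\cdot\|_2$-limit of $X(s_n)$ for any sequence of simple functions $s_n$ supported in $S_f$ with $\|s_n-f\|_2\to0$ (it exists and does not depend on the sequence). For real-valued $f\in L^1(\mathbb{R})\cap L^2(\mathbb{R})$, $X(f):=\lim_{t\to\infty}X(f\chi_{[-t,t]})$ in $\|\cdot\|_2$ (this limit exists). *)

theory Defs
  imports "HOL-Analysis.Analysis"
begin

section \<open>Complex Hilbert spaces and von Neumann algebras\<close>

text \<open>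
  A complex Hilbert space is a complete real inner product space together with a complex scalar
  multiplication and a sesquilinear inner product (linear in the first argument) whose real part
  is the real inner product, so that the norms agree.
\<close>

class complex_hilbert = real_inner + complete_space +
  fixes scaleC :: "complex \<Rightarrow> 'a \<Rightarrow> 'a"  (infixr \<open>*\<^sub>C\<close> 75)
    and cinner :: "'a \<Rightarrow> 'a \<Rightarrow> complex"
  assumes scaleC_add_right: "c *\<^sub>C (x + y) = c *\<^sub>C x + c *\<^sub>C y"
    and scaleC_add_left: "(c + d) *\<^sub>C x = c *\<^sub>C x + d *\<^sub>C x"
    and scaleC_scaleC: "c *\<^sub>C (d *\<^sub>C x) = (c * d) *\<^sub>C x"
    and scaleC_of_real: "complex_of_real r *\<^sub>C x = r *\<^sub>R x"
    and cinner_add_left: "cinner (x + y) z = cinner x z + cinner y z"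
    and cinner_scaleC_left: "cinner (c *\<^sub>C x) z = c * cinner x z"
    and cinner_commute: "cinner x y = cnj (cinner y x)"
    and inner_eq_Re_cinner: "x \<bullet> y = Re (cinner x y)"

lemma cinner_scaleC_right: "cinner x (c *\<^sub>C y) = cnj c * cinner x y"
  for x y :: "'a::complex_hilbert"
  by (metis cinner_commute cinner_scaleC_left complex_cnj_mult)

lemma cinner_same: "cinner x x = complex_of_real ((norm x)\<^sup>2)"
  for x :: "'a::complex_hilbert"
proof (rule complex_eqI)
  have "Im (cinner x x) = - Im (cinner x x)"
    using arg_cong[OF cinner_commute[of x x], of Im] by simp
  thus "Im (cinner x x) = Im (complex_of_real ((norm x)\<^sup>2))" by simp
qed (simp add: inner_eq_Re_cinner[symmetric] power2_norm_eq_inner)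

lemma norm_scaleC: "norm (c *\<^sub>C x) = cmod c * norm x"
  for x :: "'a::complex_hilbert"
proof -
  have "complex_of_real ((norm (c *\<^sub>C x))\<^sup>2) = (c * cnj c) * cinner x x"
    by (simp only: cinner_same[symmetric] cinner_scaleC_left cinner_scaleC_right
        mult.assoc mult.left_commute)
  also have "\<dots> = complex_of_real ((cmod c * norm x)\<^sup>2)"
    by (simp add: cinner_same complex_mult_cnj cmod_power2 power_mult_distrib)
  finally have "(norm (c *\<^sub>C x))\<^sup>2 = (cmod c * norm x)\<^sup>2"
    by (simp only: of_real_eq_iff)
  thus ?thesis by (rule power2_eq_imp_eq) auto
qed

lemma bounded_linear_scaleC: "bounded_linear (\<lambda>x::'a::complex_hilbert. c *\<^sub>C x)"
proof (rule bounded_linear_intro[where K = "cmod c"])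
  fix r :: real and x :: 'a
  show "c *\<^sub>C (r *\<^sub>R x) = r *\<^sub>R (c *\<^sub>C x)"
    by (simp add: scaleC_of_real[symmetric] scaleC_scaleC mult.commute)
qed (simp_all add: scaleC_add_right norm_scaleC mult.commute)

type_synonym 'h op = "'h \<Rightarrow>\<^sub>L 'h"

definition complex_linear :: "'h::complex_hilbert op \<Rightarrow> bool" where
  "complex_linear T \<longleftrightarrow> (\<forall>c x. T (c *\<^sub>C x) = c *\<^sub>C T x)"

lift_definition op_scaleC :: "complex \<Rightarrow> 'h::complex_hilbert op \<Rightarrow> 'h op"
  is "\<lambda>c T x. c *\<^sub>C T x"
  by (rule bounded_linear_compose[OF bounded_linear_scaleC])

text \<open>For a complex-linear bounded operator the adjoint exists and is unique (Riesz).\<close>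

definition adj :: "'h::complex_hilbert op \<Rightarrow> 'h op" where
  "adj T = (THE S :: 'h op. \<forall>x y. cinner (T x) y = cinner x (S y))"

definition commutant :: "'h::complex_hilbert op set \<Rightarrow> 'h op set" where
  "commutant S = {T. complex_linear T \<and> (\<forall>a\<in>S. T o\<^sub>L a = a o\<^sub>L T)}"

definition von_neumann_algebra :: "'h::complex_hilbert op set \<Rightarrow> bool" where
  "von_neumann_algebra A \<longleftrightarrow> (\<forall>a\<in>A. adj a \<in> A) \<and> commutant (commutant A) = A"

definition finite_von_neumann_algebra :: "'h::complex_hilbert op set \<Rightarrow> bool" where
  "finite_von_neumann_algebra A \<longleftrightarrow> von_neumann_algebra A \<and>
     (\<forall>u\<in>A. adj u o\<^sub>L u = id_blinfun \<longrightarrow> u o\<^sub>L adj u = id_blinfun)"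

definition self_adjoint_part :: "'h::complex_hilbert op set \<Rightarrow> 'h op set" where
  "self_adjoint_part A = {a\<in>A. adj a = a}"

definition op_le :: "'h::complex_hilbert op \<Rightarrow> 'h op \<Rightarrow> bool" where
  "op_le a b \<longleftrightarrow> (\<forall>x. Re (cinner (a x) x) \<le> Re (cinner (b x) x))"

definition is_op_lub :: "'h::complex_hilbert op set \<Rightarrow> 'h op set \<Rightarrow> 'h op \<Rightarrow> bool" where
  "is_op_lub A D s \<longleftrightarrow> s \<in> self_adjoint_part A \<and> (\<forall>a\<in>D. op_le a s) \<and>
     (\<forall>u\<in>self_adjoint_part A. (\<forall>a\<in>D. op_le a u) \<longrightarrow> op_le s u)"

section \<open>$W^*$-probability spaces\<close>

text \<open>
  Functionals on \<open>A\<close> are total functions of which only the values on \<open>A\<close> matter.  Normality is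
  preservation of suprema of upward directed families of self-adjoint elements.
\<close>

locale wstar_probability_space =
  fixes A :: "'h::complex_hilbert op set" and \<phi> :: "'h op \<Rightarrow> complex"
  assumes finite_vN: "finite_von_neumann_algebra A"
    and linear_add: "a \<in> A \<Longrightarrow> b \<in> A \<Longrightarrow> \<phi> (a + b) = \<phi> a + \<phi> b"
    and linear_scale: "a \<in> A \<Longrightarrow> \<phi> (op_scaleC c a) = c * \<phi> a"
    and positive: "a \<in> A \<Longrightarrow> \<phi> (adj a o\<^sub>L a) \<in> \<real> \<and> 0 \<le> Re (\<phi> (adj a o\<^sub>L a))"
    and unital: "\<phi> id_blinfun = 1"
    and tracial: "a \<in> A \<Longrightarrow> b \<in> A \<Longrightarrow> \<phi> (a o\<^sub>L b) = \<phi> (b o\<^sub>L a)"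
    and faithful: "a \<in> A \<Longrightarrow> \<phi> (adj a o\<^sub>L a) = 0 \<Longrightarrow> a = 0"
    and normal: "D \<subseteq> self_adjoint_part A \<Longrightarrow> D \<noteq> {} \<Longrightarrow>
          (\<And>a b. a \<in> D \<Longrightarrow> b \<in> D \<Longrightarrow> \<exists>c\<in>D. op_le a c \<and> op_le b c) \<Longrightarrow>
          is_op_lub A D s \<Longrightarrow> Re (\<phi> s) = (SUP a\<in>D. Re (\<phi> a))"

text \<open>The norm $\|a\|_2 = \varphi(|a|^2)^{1/2}$, where $|a|^2 = a^* a$.\<close>

definition trace_norm2 :: "('h::complex_hilbert op \<Rightarrow> complex) \<Rightarrow> 'h op \<Rightarrow> real" where
  "trace_norm2 \<phi> a = sqrt (Re (\<phi> (adj a o\<^sub>L a)))"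

text \<open>
  The completion of \<open>A\<close> in $\|\cdot\|_2$, determined up to isometric isomorphism over \<open>A\<close>: a
  complete space \<open>'l\<close> with an isometric linear map \<open>\<iota>\<close> of \<open>A\<close> onto a dense subspace.
\<close>

definition is_L2_completion ::
    "'h::complex_hilbert op set \<Rightarrow> ('h op \<Rightarrow> complex) \<Rightarrow> ('h op \<Rightarrow> 'l::complex_hilbert) \<Rightarrow> bool" where
  "is_L2_completion A \<phi> \<iota> \<longleftrightarrow>
     (\<forall>a\<in>A. \<forall>b\<in>A. \<iota> (a + b) = \<iota> a + \<iota> b) \<and>
     (\<forall>c. \<forall>a\<in>A. \<iota> (op_scaleC c a) = c *\<^sub>C \<iota> a) \<and>
     (\<forall>a\<in>A. norm (\<iota> a) = trace_norm2 \<phi> a) \<and>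
     closure (\<iota> ` A) = UNIV"

section \<open>Free cumulants and free independence\<close>

definition op_prod :: "'h::complex_hilbert op list \<Rightarrow> 'h op" where
  "op_prod as = foldr (o\<^sub>L) as id_blinfun"

definition noncrossing_partitions :: "nat \<Rightarrow> nat set set set" where
  "noncrossing_partitions n = {\<pi>. partition_on {..<n} \<pi> \<and>
     \<not> (\<exists>V\<in>\<pi>. \<exists>W\<in>\<pi>. V \<noteq> W \<and>
          (\<exists>a b c d. a < b \<and> b < c \<and> c < d \<and> a \<in> V \<and> c \<in> V \<and> b \<in> W \<and> d \<in> W))}"

text \<open>
  The moment-cumulant formula
  $\varphi(a_1 \cdots a_n) = \sum_{\pi \in NC(n)} \prod_{V \in \pi} \kappa_{|V|}(a_i : i \in V)$,
  solved for the term $\kappa_n(a_1,\dots,a_n)$ of the one-block partition.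
\<close>

function free_cumulant :: "('h::complex_hilbert op \<Rightarrow> complex) \<Rightarrow> 'h op list \<Rightarrow> complex" where
  "free_cumulant \<phi> as = \<phi> (op_prod as) -
     (\<Sum>\<pi>\<in>noncrossing_partitions (length as) - {{{..<length as}}}.
        \<Prod>V\<in>\<pi>. free_cumulant \<phi> (nths as V))"
  by pat_completeness simp
termination
proof (relation "Wellfounded.measure (\<lambda>(\<phi>, as). length as)")
  show "wf (Wellfounded.measure (\<lambda>(\<phi> :: 'h op \<Rightarrow> complex, as :: 'h op list). length as))"
    by simp
next
  fix \<phi> :: "'h op \<Rightarrow> complex" and as :: "'h op list" and \<pi> V
  assume \<pi>: "\<pi> \<in> noncrossing_partitions (length as) - {{{..<length as}}}" and V: "V \<in> \<pi>"
  have p: "partition_on {..<length as} \<pi>"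
    using \<pi> by (simp add: noncrossing_partitions_def)
  have sub: "V \<subseteq> {..<length as}"
    using p V by (auto simp: partition_on_def)
  have "V \<noteq> {..<length as}"
  proof
    assume full: "V = {..<length as}"
    have "W = V" if "W \<in> \<pi>" for W
    proof (rule ccontr)
      assume "W \<noteq> V"
      hence "W \<inter> V = {}" using p V that by (auto simp: partition_on_def disjoint_def)
      moreover have "W \<subseteq> V" "W \<noteq> {}" using p that full by (auto simp: partition_on_def)
      ultimately show False by auto
    qed
    hence "\<pi> = {V}" using V by blast
    thus False using \<pi> full by simp
  qed
  hence "V \<subset> {..<length as}" using sub by blast
  moreover have "{i. i < length as \<and> i \<in> V} = V" using sub by blast
  ultimately show "((\<phi>, nths as V), (\<phi>, as)) \<in> Wellfounded.measure (\<lambda>(\<phi>, as). length as)"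
    using psubset_card_mono[of "{..<length as}" V] by (simp add: length_nths)
qed

declare free_cumulant.simps [simp del]

definition unital_subalgebra :: "'h::complex_hilbert op set \<Rightarrow> bool" where
  "unital_subalgebra B \<longleftrightarrow> id_blinfun \<in> B \<and>
     (\<forall>a\<in>B. \<forall>b\<in>B. a + b \<in> B \<and> a o\<^sub>L b \<in> B) \<and> (\<forall>c. \<forall>a\<in>B. op_scaleC c a \<in> B)"

text \<open>
  Freeness of the unital algebras generated by the single elements \<open>x i\<close>, \<open>i \<in> I\<close>.  For
  self-adjoint elements these are already closed under adjoints.
\<close>

definition freely_independent ::
    "('h::complex_hilbert op \<Rightarrow> complex) \<Rightarrow> 'i set \<Rightarrow> ('i \<Rightarrow> 'h op) \<Rightarrow> bool" where
  "freely_independent \<phi> I x \<longleftrightarrow>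
     (\<forall>js as. js \<noteq> [] \<longrightarrow> set js \<subseteq> I \<longrightarrow> length as = length js \<longrightarrow> successively (\<noteq>) js \<longrightarrow>
        (\<forall>m<length js. as ! m \<in> unital_subalgebra hull {x (js ! m)} \<and> \<phi> (as ! m) = 0) \<longrightarrow>
        \<phi> (op_prod as) = 0)"

section \<open>Free Poisson random measures and their integral\<close>

definition finite_borel :: "real set set" where
  "finite_borel = {E \<in> sets borel. emeasure lborel E < \<infinity>}"

locale free_poisson_random_measure = wstar_probability_space A \<phi>
  for A :: "'h::complex_hilbert op set" and \<phi> :: "'h op \<Rightarrow> complex" +
  fixes X :: "real set \<Rightarrow> 'h op"
  assumes self_adjoint: "E \<in> finite_borel \<Longrightarrow> X E \<in> self_adjoint_part A"
    and cumulants: "E \<in> finite_borel \<Longrightarrow> 1 \<le> n \<Longrightarrow>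
          free_cumulant \<phi> (replicate n (X E)) = complex_of_real (measure lborel E)"
    and free: "(\<And>i. i < k \<Longrightarrow> F i \<in> finite_borel) \<Longrightarrow> disjoint_family_on F {..<k::nat} \<Longrightarrow>
          freely_independent \<phi> {..<k} (\<lambda>i. X (F i))"
    and additive: "(\<And>i. i < k \<Longrightarrow> F i \<in> finite_borel) \<Longrightarrow> disjoint_family_on F {..<k::nat} \<Longrightarrow>
          X (\<Union>i<k. F i) = (\<Sum>i<k. X (F i))"

definition L1_L2 :: "(real \<Rightarrow> real) set" where
  "L1_L2 = {f. integrable lebesgue f \<and> integrable lebesgue (\<lambda>x. (f x)\<^sup>2)}"

definition L1_norm :: "(real \<Rightarrow> real) \<Rightarrow> real" where
  "L1_norm f = (LINT x|lebesgue. \<bar>f x\<bar>)"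

definition L2_norm :: "(real \<Rightarrow> real) \<Rightarrow> real" where
  "L2_norm f = sqrt (LINT x|lebesgue. (f x)\<^sup>2)"

text \<open>\<open>s\<close> is a simple function and \<open>v = X(s)\<close>, computed from some representation of \<open>s\<close>.\<close>

definition has_simple_integral ::
    "(real set \<Rightarrow> 'h::complex_hilbert op) \<Rightarrow> (real \<Rightarrow> real) \<Rightarrow> 'h op \<Rightarrow> bool" where
  "has_simple_integral X s v \<longleftrightarrow>
     (\<exists>(n::nat) c E. (\<forall>i<n. E i \<in> finite_borel) \<and> disjoint_family_on E {..<n} \<and>
        s = (\<lambda>x. \<Sum>i<n. c i * indicator (E i) x) \<and> v = (\<Sum>i<n. c i *\<^sub>R X (E i)))"

text \<open>
  $X(f)$ for square integrable \<open>f\<close> with support $\{f \neq 0\}$ of finite measure; the limit is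
  taken in the completion \<open>\<iota>\<close>, and is the common one of all approximating sequences.
\<close>

definition integral_finite_support ::
    "('h::complex_hilbert op \<Rightarrow> 'l::complex_hilbert) \<Rightarrow> (real set \<Rightarrow> 'h op) \<Rightarrow> (real \<Rightarrow> real) \<Rightarrow> 'l" where
  "integral_finite_support \<iota> X f = (THE l.
     \<forall>s v. (\<forall>n. has_simple_integral X (s n) (v n)) \<longrightarrow>
       (\<forall>n x. s n x \<noteq> 0 \<longrightarrow> f x \<noteq> 0) \<longrightarrow>
       (\<lambda>n. L2_norm (\<lambda>x. s n x - f x)) \<longlonglongrightarrow> 0 \<longrightarrow>
       (\<lambda>n. \<iota> (v n)) \<longlonglongrightarrow> l)"

definition free_poisson_integral ::
    "('h::complex_hilbert op \<Rightarrow> 'l::complex_hilbert) \<Rightarrow> (real set \<Rightarrow> 'h op) \<Rightarrow> (real \<Rightarrow> real) \<Rightarrow> 'l" where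
  "free_poisson_integral \<iota> X f =
     Lim at_top (\<lambda>t::real. integral_finite_support \<iota> X (\<lambda>x. f x * indicator {-t..t} x))"

end

theory Submission
  imports Defs
begin

text \<open>
  The integral is a bounded linear map for the norm $\|f\|_1 + \|f\|_2$, because its second moment is
  explicit: for simple functions $s$,
  $$\|X(s)\|_2^2 = \int s^2 + \Big(\int s\Big)^2 \le \|s\|_2^2 + \|s\|_1^2.$$
  The formula comes from the covariance $\varphi(X_E X_F) = |E \cap F| + |E|\,|F|$
  (\<open>trace_measure_product\<close>): the first two cumulants give the case $E = F$, freeness gives
  $\varphi(X_E X_F) = |E|\,|F|$ for disjoint sets, and additivity of $X$ reduces every pair of sets to
  these two cases. Summing over all pairs of sets yields \<open>simple_integral_isometry\<close>. It is stated for
  differences, so it also gives the independence of representations and sequences that the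
  definition of the integral presupposes.

  The inequality then passes through both limits that define $X(f)$. Write $q(f)$ for
  $\|f\|_1^2 + \|f\|_2^2$. On supports of finite measure, $L^2$ approximation is also $L^1$
  approximation, so $q(s_n - f) \to 0$ for the sequences in the definition and
  \<open>integral_finite_support_dist_le\<close> follows. Dominated convergence gives $q(f \chi_{[-t,t]} - f) \to 0$, and
  the truncation limit preserves the bound: $\|X(f) - X(g)\|_2^2 \le 4\,q(f - g)$
  (\<open>free_poisson_integral_dist_le\<close>). The constant 4 is an artefact of the weak triangle inequality for $q$.

  On the operator side, the norm $\|a\|_2$ is defined through the adjoint, so it must be known that
  adjoints exist (\<open>complex_linear_adjoint_exists\<close>) before real combinations of self-adjoint elements
  can be recognised as self-adjoint.
\<close>

section \<open>Limits controlled by squared norms\<close>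

lemma convergent_if_square_dist_le_errors:
  fixes a :: "nat \<Rightarrow> 'a::{real_normed_vector, complete_space}"
  assumes q: "q \<longlonglongrightarrow> 0" and le: "\<And>m n. (norm (a m - a n))\<^sup>2 \<le> q m + q n"
  shows "convergent a"
proof (rule Cauchy_convergent, rule metric_CauchyI)
  fix e :: real assume e: "0 < e"
  obtain N where N: "\<And>n. n \<ge> N \<Longrightarrow> q n < e\<^sup>2 / 2"
    using order_tendstoD(2)[OF q, of "e\<^sup>2 / 2"] e by (auto simp: eventually_sequentially)
  have "dist (a m) (a n) < e" if "m \<ge> N" "n \<ge> N" for m n
  proof -
    have "(norm (a m - a n))\<^sup>2 < e\<^sup>2"
      using le[of m n] N[OF that(1)] N[OF that(2)] by simp
    thus ?thesis using e by (simp add: dist_norm power2_less_imp_less)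
  qed
  thus "\<exists>M. \<forall>m\<ge>M. \<forall>n\<ge>M. dist (a m) (a n) < e" by blast
qed

lemma tendsto_zero_if_square_norm_le:
  fixes a :: "'b \<Rightarrow> 'a::real_normed_vector"
  assumes le: "\<And>t. (norm (a t))\<^sup>2 \<le> q t" and q: "(q \<longlongrightarrow> 0) F"
  shows "(a \<longlongrightarrow> 0) F"
proof (rule Lim_null_comparison)
  show "\<forall>\<^sub>F t in F. norm (a t) \<le> sqrt (q t)"
    by (intro always_eventually allI real_le_rsqrt le)
  show "((\<lambda>t. sqrt (q t)) \<longlongrightarrow> 0) F" using tendsto_real_sqrt[OF q] by simp
qed

section \<open>Adjoints and bicommutants\<close>

text \<open>
  The representing vector is the minimiser of $J(x) = \|x\|^2 - 2 f(x)$: the parallelogram law turns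
  near-minimality of $u$ and $v$ into smallness of $\|u - v\|$, so a minimising sequence converges, and
  the first-order condition at its limit $l$ reads $f(h) = \langle l, h\rangle$.
\<close>

lemma Riesz_representation:
  fixes f :: "'a::{real_inner, complete_space} \<Rightarrow> real"
  assumes f: "bounded_linear f"
  shows "\<exists>x. \<forall>y. f y = x \<bullet> y"
proof -
  interpret f: bounded_linear f by fact
  define J where "J x = (norm x)\<^sup>2 - 2 * f x" for x
  obtain K where K: "\<And>x. norm (f x) \<le> norm x * K" using f.bounded by blast
  have lower: "- K\<^sup>2 \<le> J x" for x
  proof -
    have "0 \<le> (norm x - K)\<^sup>2" by simp
    thus ?thesis using K[of x] by (simp add: J_def power2_eq_square algebra_simps abs_le_iff)
  qed
  define m where "m = Inf (range J)"
  have bdd: "bdd_below (range J)" using lower by (intro bdd_belowI[of _ "- K\<^sup>2"]) auto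
  have m_le: "m \<le> J x" for x
    unfolding m_def by (rule cInf_lower[OF _ bdd]) simp
  have "\<exists>x. J x < m + inverse (real (Suc n))" for n
    using cInf_less_iff[OF _ bdd, of "m + inverse (real (Suc n))"] by (auto simp: m_def)
  then obtain x where x: "\<And>n. J (x n) < m + inverse (real (Suc n))" by metis
  have par: "(norm (u - v))\<^sup>2 \<le> 2 * (J u - m) + 2 * (J v - m)" for u v
  proof -
    have "(norm (u - v))\<^sup>2 = 2 * J u + 2 * J v - 4 * J ((1/2) *\<^sub>R (u + v))"
      unfolding J_def power2_norm_eq_inner
      by (simp add: f.add f.scaleR inner_diff_left inner_diff_right inner_add_left inner_add_right
          inner_commute algebra_simps)
    thus ?thesis using m_le[of "(1/2) *\<^sub>R (u + v)"] by simp
  qed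
  have "convergent x"
  proof (rule convergent_if_square_dist_le_errors)
    show "(\<lambda>n. 2 * inverse (real (Suc n))) \<longlonglongrightarrow> 0"
      by (rule tendsto_mult_right_zero[OF LIMSEQ_inverse_real_of_nat])
    show "(norm (x i - x j))\<^sup>2 \<le> 2 * inverse (real (Suc i)) + 2 * inverse (real (Suc j))" for i j
      using par[of "x i" "x j"] x[of i] x[of j] by simp
  qed
  then obtain l where l: "x \<longlonglongrightarrow> l" by (auto simp: convergent_def)
  have "(\<lambda>n. J (x n)) \<longlonglongrightarrow> J l"
    unfolding J_def by (intro tendsto_intros f.tendsto l)
  moreover have "(\<lambda>n. m + inverse (real (Suc n))) \<longlonglongrightarrow> m + 0"
    by (intro tendsto_intros LIMSEQ_inverse_real_of_nat)
  ultimately have Jl: "J l \<le> m"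
    using LIMSEQ_le[of "\<lambda>n. J (x n)" "J l" "\<lambda>n. m + inverse (real (Suc n))" "m + 0"] x
    by (simp del: of_nat_Suc add: less_imp_le)
  \<comment> \<open>The step \<open>t\<close> minimises $J(l + t h)$, which drops by $a^2 / \|h\|^2$ unless $a = 0$.\<close>
  have "f h = l \<bullet> h" for h
  proof (cases "h = 0")
    case False
    define a where "a = l \<bullet> h - f h"
    define t where "t = - a / (h \<bullet> h)"
    have hh: "h \<bullet> h > 0" using False by simp
    have "J (l + t *\<^sub>R h) = J l + 2 * t * a + t\<^sup>2 * (h \<bullet> h)"
      unfolding J_def a_def power2_norm_eq_inner
      by (simp add: f.add f.scaleR inner_add_left inner_add_right inner_commute
          power2_eq_square algebra_simps)
    also have "\<dots> = J l - a\<^sup>2 / (h \<bullet> h)"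
      using hh by (simp add: t_def power2_eq_square divide_simps)
    finally have "a\<^sup>2 / (h \<bullet> h) \<le> 0" using m_le[of "l + t *\<^sub>R h"] Jl by linarith
    hence "a\<^sup>2 \<le> 0" using hh by (simp add: divide_le_0_iff)
    thus ?thesis by (simp add: a_def)
  qed (simp add: f.zero)
  thus ?thesis by blast
qed

lemma cinner_add_right: "cinner x (y + z) = cinner x y + cinner x z"
  for x y z :: "'a::complex_hilbert"
  by (metis cinner_add_left cinner_commute complex_cnj_add)

lemma cinner_scaleR_left: "cinner (r *\<^sub>R x) y = complex_of_real r * cinner x y"
  for x y :: "'a::complex_hilbert"
  by (metis cinner_scaleC_left scaleC_of_real)

lemma cinner_scaleR_right: "cinner x (r *\<^sub>R y) = complex_of_real r * cinner x y"
  for x y :: "'a::complex_hilbert"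
  by (metis cinner_scaleC_right complex_cnj_complex_of_real scaleC_of_real)

text \<open>
  Recovering the complex inner product from its real part reduces complex adjoints to real ones.
\<close>

lemma cinner_eq_inner: "cinner x y = Complex (x \<bullet> y) (- ((\<i> *\<^sub>C x) \<bullet> y))"
  for x y :: "'a::complex_hilbert"
  by (rule complex_eqI) (simp_all add: inner_eq_Re_cinner cinner_scaleC_left)

text \<open>
  Without an adjoint the description defining \<open>adj\<close> would denote nothing, and \<open>adj a = a\<close> would not say
  that \<open>a\<close> is symmetric for the inner product. Existence is Riesz representation of $x \mapsto
  \mathrm{Re}\,\langle T x, y\rangle$.
\<close>

lemma complex_linear_adjoint_exists:
  fixes T :: "'h::complex_hilbert op"
  assumes T: "complex_linear T"
  shows "\<exists>S :: 'h op. \<forall>x y. cinner (T x) y = cinner x (S y)"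
proof -
  have "\<exists>z. \<forall>x. T x \<bullet> y = z \<bullet> x" for y
    by (rule Riesz_representation) (intro bounded_linear_intros)
  then obtain S where S: "\<And>x y. T x \<bullet> y = x \<bullet> S y" by (metis inner_commute)
  have lin: "bounded_linear S"
  proof (rule bounded_linear_intro)
    show "S (y + z) = S y + S z" for y z
    proof (rule vector_eq_ldot[THEN iffD1], intro allI)
      fix x show "x \<bullet> S (y + z) = x \<bullet> (S y + S z)"
        by (simp add: S[symmetric] inner_add_right)
    qed
    show "S (r *\<^sub>R y) = r *\<^sub>R S y" for r y
    proof (rule vector_eq_ldot[THEN iffD1], intro allI)
      fix x show "x \<bullet> S (r *\<^sub>R y) = x \<bullet> r *\<^sub>R S y"
        by (simp add: S[symmetric])
    qed
    show "norm (S y) \<le> norm y * norm T" for y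
    proof (cases "S y = 0")
      case False
      have "(norm (S y))\<^sup>2 = T (S y) \<bullet> y" by (simp add: S power2_norm_eq_inner)
      also have "\<dots> \<le> norm (T (S y)) * norm y" by (rule norm_cauchy_schwarz)
      also have "\<dots> \<le> (norm T * norm (S y)) * norm y"
        by (intro mult_right_mono norm_blinfun) simp
      finally show ?thesis using False by (simp add: power2_eq_square mult_ac)
    qed simp
  qed
  have "cinner (T x) y = cinner x (S y)" for x y
    using T by (simp add: cinner_eq_inner complex_linear_def S[symmetric])
  thus ?thesis
    by (intro exI[of _ "Blinfun S"]) (simp add: bounded_linear_Blinfun_apply[OF lin])
qed

lemma adj_eqI:
  fixes S T :: "'h::complex_hilbert op"
  assumes S: "\<And>x y. cinner (T x) y = cinner x (S y)"
  shows "adj T = S"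
  unfolding adj_def
proof (rule the_equality)
  fix R :: "'h op" assume R: "\<forall>x y. cinner (T x) y = cinner x (R y)"
  have "R y = S y" for y
    by (rule vector_eq_ldot[THEN iffD1]) (metis R S inner_eq_Re_cinner)
  thus "R = S" by (rule blinfun_eqI)
qed (use S in blast)

lemma cinner_adj:
  fixes T :: "'h::complex_hilbert op"
  assumes "complex_linear T"
  shows "cinner (T x) y = cinner x (adj T y)"
  using complex_linear_adjoint_exists[OF assms] adj_eqI by metis

lemma op_eq_iff: "S = T \<longleftrightarrow> (\<forall>x. S x = T x)" for S T :: "'h::complex_hilbert op"
  by (auto intro: blinfun_eqI)

text \<open>
  A von Neumann algebra is given here as a bicommutant, so its algebraic closure properties are
  inherited from those of commutants.
\<close>

lemma commutant_complex_linear: "T \<in> commutant S \<Longrightarrow> complex_linear T"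
  by (simp add: commutant_def)

lemma commutant_zero: "0 \<in> commutant S"
  by (auto simp: commutant_def complex_linear_def
      linear_0[OF bounded_linear.linear[OF bounded_linear_scaleC]]
      bounded_bilinear.zero_left[OF bounded_bilinear_blinfun_compose]
      bounded_bilinear.zero_right[OF bounded_bilinear_blinfun_compose])

lemma commutant_id: "id_blinfun \<in> commutant S"
  by (auto simp: commutant_def complex_linear_def intro!: blinfun_eqI)

lemma commutant_add: "T \<in> commutant S \<Longrightarrow> U \<in> commutant S \<Longrightarrow> T + U \<in> commutant S"
  by (auto simp: commutant_def complex_linear_def blinfun.add_left scaleC_add_right
      bounded_bilinear.add_left[OF bounded_bilinear_blinfun_compose]
      bounded_bilinear.add_right[OF bounded_bilinear_blinfun_compose])

lemma commutant_compose: "T \<in> commutant S \<Longrightarrow> U \<in> commutant S \<Longrightarrow> T o\<^sub>L U \<in> commutant S"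
  by (auto simp: commutant_def complex_linear_def op_eq_iff)

text \<open>
  Complex multiples commute with \<open>S\<close> only because the members of \<open>S\<close> are complex linear; for a
  bicommutant, \<open>S\<close> is itself a commutant.
\<close>

lemma commutant_scaleC:
  assumes "\<And>a. a \<in> S \<Longrightarrow> complex_linear a" "T \<in> commutant S"
  shows "op_scaleC c T \<in> commutant S"
  using assms
  by (auto simp: commutant_def complex_linear_def op_scaleC.rep_eq scaleC_scaleC mult.commute
      op_eq_iff)

lemma op_scaleC_of_real: "op_scaleC (complex_of_real r) T = r *\<^sub>R T"
  by (rule blinfun_eqI) (simp add: op_scaleC.rep_eq scaleC_of_real blinfun.scaleR_left)

section \<open>The trace on real combinations of self-adjoint elements\<close>

context wstar_probability_space
begin

lemma algebra_bicommutant: "commutant (commutant A) = A"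
  using finite_vN by (simp add: finite_von_neumann_algebra_def von_neumann_algebra_def)

lemma algebra_complex_linear: "a \<in> A \<Longrightarrow> complex_linear a"
  using commutant_complex_linear algebra_bicommutant by blast

lemma algebra_zero: "0 \<in> A"
  using commutant_zero algebra_bicommutant by blast

lemma algebra_id: "id_blinfun \<in> A"
  using commutant_id algebra_bicommutant by blast

lemma algebra_add: "a \<in> A \<Longrightarrow> b \<in> A \<Longrightarrow> a + b \<in> A"
  using commutant_add algebra_bicommutant by blast

lemma algebra_compose: "a \<in> A \<Longrightarrow> b \<in> A \<Longrightarrow> a o\<^sub>L b \<in> A"
  using commutant_compose algebra_bicommutant by blast

lemma algebra_scaleC: "a \<in> A \<Longrightarrow> op_scaleC c a \<in> A"
  using commutant_scaleC[of "commutant A" a c] commutant_complex_linear algebra_bicommutant by blast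

lemma algebra_scaleR: "a \<in> A \<Longrightarrow> r *\<^sub>R a \<in> A"
  using algebra_scaleC[of a "complex_of_real r"] by (simp add: op_scaleC_of_real)

lemma trace_scaleR: "a \<in> A \<Longrightarrow> \<phi> (r *\<^sub>R a) = complex_of_real r * \<phi> a"
  using linear_scale[of a "complex_of_real r"] by (simp add: op_scaleC_of_real)

lemma trace_zero: "\<phi> 0 = 0"
  using trace_scaleR[OF algebra_zero, of 0] by simp

lemma algebra_sum: "(\<And>i. i \<in> I \<Longrightarrow> a i \<in> A) \<Longrightarrow> (\<Sum>i\<in>I. a i) \<in> A"
  by (induction I rule: infinite_finite_induct) (auto simp: algebra_zero algebra_add)

lemma trace_sum: "(\<And>i. i \<in> I \<Longrightarrow> a i \<in> A) \<Longrightarrow> \<phi> (\<Sum>i\<in>I. a i) = (\<Sum>i\<in>I. \<phi> (a i))"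
  by (induction I rule: infinite_finite_induct)
    (auto simp: trace_zero linear_add algebra_sum)

lemma adj_real_combination:
  assumes "\<And>i. i \<in> I \<Longrightarrow> a i \<in> self_adjoint_part A"
  shows "adj (\<Sum>i\<in>I. c i *\<^sub>R a i) = (\<Sum>i\<in>I. c i *\<^sub>R a i)"
proof (rule adj_eqI)
  fix x y
  show "cinner ((\<Sum>i\<in>I. c i *\<^sub>R a i) x) y = cinner x ((\<Sum>i\<in>I. c i *\<^sub>R a i) y)"
    using assms
  proof (induction I rule: infinite_finite_induct)
    case (insert i I)
    have i: "a i \<in> A" "adj (a i) = a i"
      using insert.prems[of i] by (auto simp: self_adjoint_part_def)
    have "cinner (a i x) y = cinner x (a i y)"
      using cinner_adj[OF algebra_complex_linear[OF i(1)]] i(2) by metis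
    thus ?case using insert
      by (simp add: blinfun.add_left blinfun.scaleR_left cinner_add_left cinner_add_right
          cinner_scaleR_left cinner_scaleR_right)
  qed (use cinner_scaleR_left[of 0 0 y] cinner_scaleR_right[of x 0 0] in simp_all)
qed

text \<open>
  A real combination $u$ of self-adjoint elements is self-adjoint, so $\|u\|_2^2 = \varphi(u^2)$ and the
  2-norm is governed by the traces of the pairwise products alone.
\<close>

lemma trace_norm2_real_combination:
  assumes a: "\<And>i. i \<in> I \<Longrightarrow> a i \<in> self_adjoint_part A"
  shows "(trace_norm2 \<phi> (\<Sum>i\<in>I. c i *\<^sub>R a i))\<^sup>2 =
    Re (\<Sum>i\<in>I. \<Sum>j\<in>I. complex_of_real (c i * c j) * \<phi> (a i o\<^sub>L a j))"
proof -
  have aA: "a i \<in> A" if "i \<in> I" for i using a[OF that] by (simp add: self_adjoint_part_def)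
  define u where "u = (\<Sum>i\<in>I. c i *\<^sub>R a i)"
  have uA: "u \<in> A" unfolding u_def by (intro algebra_sum algebra_scaleR aA)
  have "u o\<^sub>L u = (\<Sum>i\<in>I. \<Sum>j\<in>I. (c i * c j) *\<^sub>R (a i o\<^sub>L a j))"
    unfolding u_def
    by (simp add: bounded_bilinear.sum_left[OF bounded_bilinear_blinfun_compose]
        bounded_bilinear.sum_right[OF bounded_bilinear_blinfun_compose]
        bounded_bilinear.scaleR_left[OF bounded_bilinear_blinfun_compose]
        bounded_bilinear.scaleR_right[OF bounded_bilinear_blinfun_compose] scaleR_sum_right)
      (subst sum.swap, simp add: mult.commute)
  hence "\<phi> (u o\<^sub>L u) = (\<Sum>i\<in>I. \<Sum>j\<in>I. complex_of_real (c i * c j) * \<phi> (a i o\<^sub>L a j))"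
    by (simp add: trace_sum trace_scaleR algebra_sum algebra_scaleR algebra_compose aA)
  moreover have "adj u = u" unfolding u_def by (rule adj_real_combination) (rule a)
  moreover have "0 \<le> Re (\<phi> (adj u o\<^sub>L u))" using positive[OF uA] by blast
  ultimately show ?thesis by (simp add: trace_norm2_def u_def)
qed

end

section \<open>Free cumulants of orders one and two\<close>

lemma op_prod_singleton: "op_prod [a] = a" for a :: "'h::complex_hilbert op"
  by (simp add: op_prod_def op_eq_iff)

lemma op_prod_pair: "op_prod [a, b] = a o\<^sub>L b" for a :: "'h::complex_hilbert op"
  by (simp add: op_prod_def op_eq_iff)

lemma free_cumulant_1: "free_cumulant \<phi> [a] = \<phi> a"
proof -
  have "noncrossing_partitions 1 - {{{..<1}}} = {}"
  proof -
    have "\<pi> = {{0}}" if "partition_on {..<1::nat} \<pi>" for \<pi>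
    proof -
      have "\<pi> \<subseteq> Pow {0} - {{}}" using that by (auto simp: partition_on_def)
      also have "\<dots> = {{0}}" by (auto simp: Pow_insert)
      finally show ?thesis using that by (auto simp: partition_on_def subset_singleton_iff)
    qed
    thus ?thesis by (auto simp: noncrossing_partitions_def lessThan_Suc)
  qed
  hence *: "noncrossing_partitions (length [a]) - {{{..<length [a]}}} = {}" by simp
  show ?thesis
    by (subst free_cumulant.simps) (simp only: *, simp add: op_prod_singleton)
qed

lemma noncrossing_partitions_2: "noncrossing_partitions 2 - {{{..<2}}} = {{{0}, {1}}}"
proof -
  have two: "{..<2} = {0, 1::nat}" by auto
  have "\<pi> = {{0}, {1}} \<or> \<pi> = {{0, 1}}" if p: "partition_on {0, 1::nat} \<pi>" for \<pi>
  proof -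
    have "\<Union>\<pi> = {0, 1}" "{} \<notin> \<pi>"
      using partition_onD1[OF p] partition_onD3[OF p] by metis+
    hence "\<pi> \<subseteq> Pow {0, 1}" by blast
    hence "x = {0} \<or> x = {1} \<or> x = {0, 1}" if "x \<in> \<pi>" for x
      using that \<open>{} \<notin> \<pi>\<close> unfolding Pow_insert Pow_empty by (cases "x = {}") auto
    hence "\<pi> \<subseteq> {{0}, {1}, {0, 1}}" by blast
    hence "\<pi> \<in> Pow {{0}, {1}, {0, 1}}" by simp
    moreover note \<open>\<Union>\<pi> = {0, 1}\<close> partition_onD2[OF p]
    ultimately show ?thesis
      by (simp add: Pow_insert) (elim disjE; simp add: disjoint_def pairwise_def doubleton_eq_iff)
  qed
  moreover have "{{0}, {1}} \<in> noncrossing_partitions 2"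
    by (auto simp: noncrossing_partitions_def partition_on_def disjoint_def two)
  ultimately show ?thesis
    by (auto simp: noncrossing_partitions_def two doubleton_eq_iff)
qed

lemma free_cumulant_2: "free_cumulant \<phi> [a, a] = \<phi> (a o\<^sub>L a) - (\<phi> a)\<^sup>2"
proof -
  have *: "noncrossing_partitions (length [a, a]) - {{{..<length [a, a]}}} = {{{0}, {1}}}"
    using noncrossing_partitions_2 by (simp add: numeral_2_eq_2)
  have "(\<Prod>V\<in>{{0}, {1}}. free_cumulant \<phi> (nths [a, a] V)) = \<phi> a * \<phi> a"
    by (simp add: nths_Cons free_cumulant_1)
  thus ?thesis
    by (subst free_cumulant.simps, subst *) (simp add: op_prod_pair power2_eq_square)
qed

section \<open>Covariance of the random measure\<close>

context free_poisson_random_measure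
begin

lemma measure_in_algebra: "E \<in> finite_borel \<Longrightarrow> X E \<in> A"
  using self_adjoint by (simp add: self_adjoint_part_def)

lemma trace_measure: "E \<in> finite_borel \<Longrightarrow> \<phi> (X E) = complex_of_real (measure lborel E)"
  using cumulants[of E 1] by (simp add: free_cumulant_1)

lemma trace_measure_square:
  assumes "E \<in> finite_borel"
  shows "\<phi> (X E o\<^sub>L X E) = complex_of_real (measure lborel E + (measure lborel E)\<^sup>2)"
proof -
  have "replicate 2 (X E) = [X E, X E]" by (simp add: numeral_2_eq_2)
  thus ?thesis
    using cumulants[OF assms, of 2] trace_measure[OF assms]
    by (simp add: free_cumulant_2 diff_eq_eq)
qed

text \<open>
  Freeness is used only here, through the alternating word of length two: the product of the centred
  elements $X_E - |E|$ and $X_F - |F|$ has trace zero.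
\<close>

lemma trace_measure_disjoint:
  assumes E: "E \<in> finite_borel" and F: "F \<in> finite_borel" and disj: "E \<inter> F = {}"
  shows "\<phi> (X E o\<^sub>L X F) = complex_of_real (measure lborel E * measure lborel F)"
proof -
  define G where "G i = (if i = 0 then E else F)" for i :: nat
  \<comment> \<open>\<open>X D + e D\<close> is \<open>X D\<close> centred.\<close>
  define e where "e D = (- measure lborel D) *\<^sub>R (id_blinfun :: 'h op)" for D :: "real set"
  have eA: "e D \<in> A" for D unfolding e_def by (intro algebra_scaleR algebra_id)
  have trace_e: "\<phi> (e D) = - complex_of_real (measure lborel D)" for D
    unfolding e_def trace_scaleR[OF algebra_id] by (simp add: unital)
  have hull: "X D + e D \<in> unital_subalgebra hull {X D}" for D
  proof -
    have "e D = op_scaleC (complex_of_real (- measure lborel D)) id_blinfun"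
      unfolding e_def by (simp only: op_scaleC_of_real)
    moreover have "x + op_scaleC c id_blinfun \<in> unital_subalgebra hull {x}" for x :: "'h op" and c
      by (simp add: hull_def unital_subalgebra_def)
    ultimately show ?thesis by metis
  qed
  have centred: "\<phi> (X D + e D) = 0" if "D \<in> finite_borel" for D
    using that by (simp add: linear_add measure_in_algebra eA trace_measure trace_e)
  have "freely_independent \<phi> {..<2} (\<lambda>i. X (G i))"
    using disj by (intro free) (auto simp: G_def E F disjoint_family_on_def less_2_cases_iff)
  hence "\<phi> (op_prod [X E + e E, X F + e F]) = 0"
    unfolding freely_independent_def
    using hull centred[OF E] centred[OF F]
    by (elim allE[of _ "[0, 1]"] allE[of _ "[X E + e E, X F + e F]"])
      (simp add: G_def less_Suc_eq all_conj_distrib)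
  hence "\<phi> ((X E + e E) o\<^sub>L (X F + e F)) = 0" by (simp add: op_prod_pair)
  moreover define p q where "p = (- measure lborel F) *\<^sub>R X E"
    and "q = (- measure lborel E) *\<^sub>R (X F + e F)"
  have "(X E + e E) o\<^sub>L (X F + e F) = (X E o\<^sub>L X F) + (p + q)"
    unfolding p_def q_def
    by (rule blinfun_eqI) (simp add: e_def blinfun.bilinear_simps scaleR_diff_right)
  moreover have "p \<in> A" "q \<in> A"
    unfolding p_def q_def by (intro algebra_scaleR algebra_add measure_in_algebra eA E F)+
  moreover have "\<phi> p = - complex_of_real (measure lborel E * measure lborel F)"
    unfolding p_def trace_scaleR[OF measure_in_algebra[OF E]] by (simp add: trace_measure E)
  moreover have "\<phi> q = 0"
    unfolding q_def trace_scaleR[OF algebra_add[OF measure_in_algebra[OF F] eA]]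
    by (simp add: centred F)
  ultimately show ?thesis
    using E F by (simp add: linear_add algebra_add algebra_compose measure_in_algebra)
qed

text \<open>
  Cutting a set along another one reduces overlapping pairs of sets to equal or disjoint ones.
\<close>

lemma measure_split:
  assumes E: "E \<in> finite_borel" and F: "F \<in> sets borel"
  shows "X E = X (E \<inter> F) + X (E - F)"
    and "measure lborel E = measure lborel (E \<inter> F) + measure lborel (E - F)"
    and "E \<inter> F \<in> finite_borel" "E - F \<in> finite_borel"
proof -
  show fin: "E \<inter> F \<in> finite_borel" "E - F \<in> finite_borel"
    using E F emeasure_mono[of "E \<inter> F" E lborel] emeasure_mono[of "E - F" E lborel]
    by (auto simp: finite_borel_def intro: le_less_trans)
  define G where "G i = (if i = 0 then E \<inter> F else E - F)" for i :: nat
  have "X (\<Union>i<2. G i) = (\<Sum>i<2. X (G i))"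
    by (intro additive) (auto simp: G_def fin disjoint_family_on_def less_2_cases_iff)
  moreover have "(\<Union>i<2. G i) = E" by (auto simp: G_def numeral_2_eq_2 lessThan_Suc)
  ultimately show "X E = X (E \<inter> F) + X (E - F)"
    by (simp add: G_def numeral_2_eq_2)
  show "measure lborel E = measure lborel (E \<inter> F) + measure lborel (E - F)"
    using measure_Union[of lborel "E \<inter> F" "E - F"] fin
    by (simp add: finite_borel_def Int_Diff_Un Int_Diff_disjoint less_top[symmetric])
qed

text \<open>
  Split both sets along their intersection. The diagonal term contributes $|E \cap F| + |E \cap F|^2$;
  the off-diagonal terms complete the square to $|E|\,|F|$.
\<close>

lemma trace_measure_product:
  assumes E: "E \<in> finite_borel" and F: "F \<in> finite_borel"
  shows "\<phi> (X E o\<^sub>L X F) =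
    complex_of_real (measure lborel (E \<inter> F) + measure lborel E * measure lborel F)"
proof -
  have b: "E \<in> sets borel" "F \<in> sets borel" using E F by (auto simp: finite_borel_def)
  note sE = measure_split[OF E b(2)] and sF = measure_split[OF F b(1)]
  let ?D = "E \<inter> F" and ?P = "E - F" and ?R = "F - E"
  have c: "F \<inter> E = ?D" by blast
  have "X E o\<^sub>L X F = (X ?D + X ?P) o\<^sub>L (X ?D + X ?R)"
    using sE(1) sF(1) c by simp
  also have "\<dots> = (X ?D o\<^sub>L X ?D) + ((X ?D o\<^sub>L X ?R) + ((X ?P o\<^sub>L X ?D) + (X ?P o\<^sub>L X ?R)))"
    by (rule blinfun_eqI) (simp add: blinfun.bilinear_simps)
  finally have "X E o\<^sub>L X F =
      (X ?D o\<^sub>L X ?D) + ((X ?D o\<^sub>L X ?R) + ((X ?P o\<^sub>L X ?D) + (X ?P o\<^sub>L X ?R)))" .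
  moreover have "?D \<inter> ?R = {}" "?P \<inter> ?D = {}" "?P \<inter> ?R = {}" by blast+
  ultimately have "\<phi> (X E o\<^sub>L X F) = complex_of_real
      (measure lborel ?D + (measure lborel ?D)\<^sup>2 + (measure lborel ?D * measure lborel ?R +
        (measure lborel ?P * measure lborel ?D + measure lborel ?P * measure lborel ?R)))"
    using sE(3,4) sF(4)
    by (simp add: linear_add algebra_add algebra_compose measure_in_algebra trace_measure_square
        trace_measure_disjoint)
  thus ?thesis
    by (subst sE(2), subst sF(2)) (simp add: c power2_eq_square algebra_simps)
qed

end

section \<open>A quasi-norm on the intersection of $L^1$ and $L^2$\<close>

text \<open>
  Squaring the two norms makes the triangle inequality hold only up to the factor 2, which is harmless
  for limits, and lets it follow from $(a - b)^2 \le 2 a^2 + 2 b^2$ under the integral, with no appeal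
  to the Minkowski inequality.
\<close>

definition L1_L2_size :: "(real \<Rightarrow> real) \<Rightarrow> real" where
  "L1_L2_size u = (L1_norm u)\<^sup>2 + (L2_norm u)\<^sup>2"

lemma L2_norm_square: "(L2_norm u)\<^sup>2 = (LINT x|lebesgue. (u x)\<^sup>2)"
  by (simp add: L2_norm_def)

lemma L1_L2_size_nonneg: "0 \<le> L1_L2_size u"
  by (simp add: L1_L2_size_def)

lemma integrable_lebesgue_if_abs_le:
  fixes u :: "real \<Rightarrow> real"
  assumes "integrable lebesgue w" "u \<in> borel_measurable lebesgue" "\<And>x. \<bar>u x\<bar> \<le> w x"
  shows "integrable lebesgue u"
  by (rule Bochner_Integration.integrable_bound[OF assms(1,2)], rule AE_I2)
    (use order_trans[OF assms(3) abs_ge_self] in simp)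

lemma square_diff_le: "(a - b)\<^sup>2 \<le> 2 * a\<^sup>2 + 2 * b\<^sup>2" for a b :: real
  using zero_le_power2[of "a + b"] by (simp add: power2_sum power2_diff)

lemma L1_L2_diff:
  assumes u: "u \<in> L1_L2" and w: "w \<in> L1_L2"
  shows "(\<lambda>x. u x - w x) \<in> L1_L2"
    and "L1_L2_size (\<lambda>x. u x - w x) \<le> 2 * L1_L2_size u + 2 * L1_L2_size w"
proof -
  have i: "integrable lebesgue u" "integrable lebesgue w"
    "integrable lebesgue (\<lambda>x. (u x)\<^sup>2)" "integrable lebesgue (\<lambda>x. (w x)\<^sup>2)"
    using u w by (auto simp: L1_L2_def)
  note [measurable] = borel_measurable_integrable[OF i(1)] borel_measurable_integrable[OF i(2)]
  have i1: "integrable lebesgue (\<lambda>x. u x - w x)" using i by simp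
  have is2: "integrable lebesgue (\<lambda>x. 2 * (u x)\<^sup>2 + 2 * (w x)\<^sup>2)" using i by simp
  have i2: "integrable lebesgue (\<lambda>x. (u x - w x)\<^sup>2)"
    by (rule integrable_lebesgue_if_abs_le[OF is2]) (simp_all add: square_diff_le)
  show "(\<lambda>x. u x - w x) \<in> L1_L2" using i1 i2 by (simp add: L1_L2_def)
  have "L1_norm (\<lambda>x. u x - w x) \<le> (LINT x|lebesgue. \<bar>u x\<bar> + \<bar>w x\<bar>)"
    unfolding L1_norm_def using i i1 by (intro integral_mono) auto
  also have "\<dots> = L1_norm u + L1_norm w" unfolding L1_norm_def using i by simp
  finally have "(L1_norm (\<lambda>x. u x - w x))\<^sup>2 \<le> (L1_norm u + L1_norm w)\<^sup>2"
    by (rule power_mono) (simp add: L1_norm_def)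
  also have "\<dots> \<le> 2 * (L1_norm u)\<^sup>2 + 2 * (L1_norm w)\<^sup>2"
    using square_diff_le[of "L1_norm u" "- L1_norm w"] by simp
  finally have *: "(L1_norm (\<lambda>x. u x - w x))\<^sup>2 \<le> 2 * (L1_norm u)\<^sup>2 + 2 * (L1_norm w)\<^sup>2" .
  have "(LINT x|lebesgue. (u x - w x)\<^sup>2) \<le> (LINT x|lebesgue. 2 * (u x)\<^sup>2 + 2 * (w x)\<^sup>2)"
    using i2 is2 by (intro integral_mono) (auto simp: square_diff_le)
  also have "\<dots> = 2 * (LINT x|lebesgue. (u x)\<^sup>2) + 2 * (LINT x|lebesgue. (w x)\<^sup>2)"
    using i by simp
  finally show "L1_L2_size (\<lambda>x. u x - w x) \<le> 2 * L1_L2_size u + 2 * L1_L2_size w"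
    using * by (simp add: L1_L2_size_def L2_norm_square)
qed

lemma L1_L2_size_triangle:
  assumes "u \<in> L1_L2" "v \<in> L1_L2" "w \<in> L1_L2"
  shows "L1_L2_size (\<lambda>x. u x - v x) \<le>
    2 * L1_L2_size (\<lambda>x. u x - w x) + 2 * L1_L2_size (\<lambda>x. v x - w x)"
  using L1_L2_diff(2)[OF L1_L2_diff(1)[OF assms(1,3)] L1_L2_diff(1)[OF assms(2,3)]] by simp

text \<open>
  A Cauchy--Schwarz estimate: integrate $(|u| - c \chi_S)^2 \ge 0$ for a suitable constant $c$. Using
  $1 + |S|$ rather than $|S|$ avoids a separate treatment of null sets.
\<close>

lemma L1_norm_le_L2_norm_of_finite_support:
  assumes u: "u \<in> L1_L2" and S: "S \<in> lmeasurable" and supp: "\<And>x. u x \<noteq> 0 \<Longrightarrow> x \<in> S"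
  shows "(L1_norm u)\<^sup>2 \<le> (1 + measure lebesgue S) * (L2_norm u)\<^sup>2"
proof -
  define M where "M = measure lebesgue S"
  \<comment> \<open>This is the minimiser of the resulting quadratic in \<open>c\<close>, with \<open>1 + M\<close> in place of \<open>M\<close>.\<close>
  define c where "c = L1_norm u / (1 + M)"
  have M: "M \<ge> 0" by (simp add: M_def)
  have i: "integrable lebesgue (\<lambda>x. \<bar>u x\<bar>)" "integrable lebesgue (\<lambda>x. (u x)\<^sup>2)"
    "integrable lebesgue (indicator S :: real \<Rightarrow> real)"
    using u S by (auto simp: L1_L2_def fmeasurable_def)
  have "(\<bar>u x\<bar> - c * indicator S x)\<^sup>2 = (u x)\<^sup>2 - 2 * c * \<bar>u x\<bar> + c\<^sup>2 * indicator S x" for x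
    using supp[of x] by (cases "x \<in> S") (auto simp: power2_diff)
  hence "0 \<le> (u x)\<^sup>2 - 2 * c * \<bar>u x\<bar> + c\<^sup>2 * indicator S x" for x
    by (metis zero_le_power2)
  hence "0 \<le> (LINT x|lebesgue. (u x)\<^sup>2 - 2 * c * \<bar>u x\<bar> + c\<^sup>2 * indicator S x)"
    by (intro integral_nonneg_AE) simp
  also have "\<dots> = (L2_norm u)\<^sup>2 - 2 * c * L1_norm u + c\<^sup>2 * M"
    using i by (simp add: L2_norm_square L1_norm_def M_def)
  also have "\<dots> \<le> (L2_norm u)\<^sup>2 - 2 * c * L1_norm u + c\<^sup>2 * (1 + M)"
    by (simp add: algebra_simps)
  also have "c\<^sup>2 * (1 + M) = c * L1_norm u"
    using M by (simp add: c_def power2_eq_square)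
  finally have "c * L1_norm u \<le> (L2_norm u)\<^sup>2" by simp
  thus ?thesis using M by (simp add: c_def M_def[symmetric] power2_eq_square field_simps)
qed

lemma L1_L2_truncation:
  assumes f: "f \<in> L1_L2" and T: "T \<in> sets lebesgue"
  shows "(\<lambda>x. f x * indicator T x) \<in> L1_L2"
    and "L1_L2_size (\<lambda>x. f x * indicator T x) \<le> L1_L2_size f"
proof -
  have i: "integrable lebesgue f" "integrable lebesgue (\<lambda>x. (f x)\<^sup>2)"
    using f by (auto simp: L1_L2_def)
  note [measurable] = borel_measurable_integrable[OF i(1)] T
  have i1: "integrable lebesgue (\<lambda>x. f x * indicator T x)"
    by (rule integrable_lebesgue_if_abs_le[of "\<lambda>x. \<bar>f x\<bar>"]) (use i in \<open>auto simp: indicator_def\<close>)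
  moreover have i2: "integrable lebesgue (\<lambda>x. (f x * indicator T x)\<^sup>2)"
    by (rule integrable_lebesgue_if_abs_le[OF i(2)]) (auto simp: indicator_def)
  ultimately show "(\<lambda>x. f x * indicator T x) \<in> L1_L2" by (simp add: L1_L2_def)
  have "L1_norm (\<lambda>x. f x * indicator T x) \<le> L1_norm f"
    unfolding L1_norm_def using i(1) i1 by (intro integral_mono) (auto simp: indicator_def)
  hence "(L1_norm (\<lambda>x. f x * indicator T x))\<^sup>2 \<le> (L1_norm f)\<^sup>2"
    by (rule power_mono) (simp add: L1_norm_def)
  moreover have "(L2_norm (\<lambda>x. f x * indicator T x))\<^sup>2 \<le> (L2_norm f)\<^sup>2"
    unfolding L2_norm_square using i(2) i2 by (intro integral_mono) (auto simp: indicator_def)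
  ultimately show "L1_L2_size (\<lambda>x. f x * indicator T x) \<le> L1_L2_size f"
    by (simp add: L1_L2_size_def)
qed

lemma L1_L2_truncation_tendsto:
  assumes f: "f \<in> L1_L2"
  shows "((\<lambda>t::real. L1_L2_size (\<lambda>x. f x * indicator {-t..t} x - f x)) \<longlongrightarrow> 0) at_top"
proof -
  have i: "integrable lebesgue f" "integrable lebesgue (\<lambda>x. (f x)\<^sup>2)"
    using f by (auto simp: L1_L2_def)
  have "(\<lambda>x. f x * indicator {-t..t} x - f x) \<in> L1_L2" for t
    by (intro L1_L2_diff(1) L1_L2_truncation(1) f) simp
  hence [measurable]: "(\<lambda>x. f x * indicator {-t..t} x - f x) \<in> borel_measurable lebesgue" for t
    by (simp add: L1_L2_def borel_measurable_integrable)
  have eventually_0: "\<forall>\<^sub>F t in at_top. f x * indicator {-t..t} x - f x = 0" for x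
    using eventually_ge_at_top[of "\<bar>x\<bar>"]
    by eventually_elim (auto simp: indicator_def)
  have "((\<lambda>t::real. LINT x|lebesgue. \<bar>f x * indicator {-t..t} x - f x\<bar>) \<longlongrightarrow>
      integral\<^sup>L lebesgue (\<lambda>_::real. 0::real)) at_top"
  proof (rule integral_dominated_convergence_at_top[where w = "\<lambda>x. \<bar>f x\<bar>"])
    show "AE x in lebesgue. ((\<lambda>t. \<bar>f x * indicator {-t..t} x - f x\<bar>) \<longlongrightarrow> 0) at_top"
      by (intro AE_I2 tendsto_eventually) (use eventually_0 in \<open>simp add: abs_eq_0\<close>)
    show "\<forall>\<^sub>F t in at_top. AE x in lebesgue.
        norm \<bar>f x * indicator {-t..t} x - f x\<bar> \<le> \<bar>f x\<bar>"
      by (intro always_eventually allI AE_I2) (simp add: indicator_def)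
  qed (use i in simp_all)
  moreover have "((\<lambda>t::real. LINT x|lebesgue. (f x * indicator {-t..t} x - f x)\<^sup>2) \<longlongrightarrow>
      integral\<^sup>L lebesgue (\<lambda>_::real. 0::real)) at_top"
  proof (rule integral_dominated_convergence_at_top[where w = "\<lambda>x. (f x)\<^sup>2"])
    show "AE x in lebesgue. ((\<lambda>t. (f x * indicator {-t..t} x - f x)\<^sup>2) \<longlongrightarrow> 0) at_top"
      by (intro AE_I2 tendsto_eventually) (use eventually_0 in \<open>simp add: power2_eq_square\<close>)
    show "\<forall>\<^sub>F t in at_top. AE x in lebesgue.
        norm ((f x * indicator {-t..t} x - f x)\<^sup>2) \<le> (f x)\<^sup>2"
      by (intro always_eventually allI AE_I2) (simp add: indicator_def)
  qed (use i in simp_all)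
  ultimately show ?thesis
    unfolding L1_L2_size_def L2_norm_square L1_norm_def
    by (auto intro!: tendsto_eq_intros)
qed

section \<open>Approximation by simple functions\<close>

text \<open>
  The level sets of the nonzero values, enumerated by natural numbers, give the required disjoint
  representation; the value 0 is left out because its level set has infinite measure.
\<close>

lemma simple_function_has_simple_integral:
  assumes s: "simple_function lborel s" and fin: "emeasure lborel {x. s x \<noteq> 0} < \<infinity>"
  shows "\<exists>v. has_simple_integral X s v"
proof -
  define R where "R = range s - {0}"
  have R: "finite R" using simple_functionD(1)[OF s] by (simp add: R_def)
  obtain h where h: "bij_betw h {..<card R} R"
    using ex_bij_betw_nat_finite[OF R] by (auto simp: atLeast0LessThan)
  define E where "E i = s -` {h i}" for i
  have h_nz: "h i \<noteq> 0" if "i < card R" for i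
    using bij_betwE[OF h] that by (auto simp: R_def)
  have E: "E i \<in> finite_borel" if "i < card R" for i
  proof -
    have "{x. s x \<noteq> 0} \<in> sets borel"
      using borel_measurable_simple_function[OF s] by measurable
    hence "emeasure lborel (E i) \<le> emeasure lborel {x. s x \<noteq> 0}"
      using h_nz[OF that] by (intro emeasure_mono) (auto simp: E_def)
    thus ?thesis
      using simple_functionD(2)[OF s, of "{h i}"] fin by (auto simp: finite_borel_def E_def)
  qed
  have disj: "disjoint_family_on E {..<card R}"
    using bij_betw_imp_inj_on[OF h] by (auto simp: disjoint_family_on_def E_def inj_on_def)
  have "s x = (\<Sum>i<card R. h i * indicator (E i) x)" for x
  proof -
    have "(\<Sum>i<card R. h i * indicator (E i) x) = (\<Sum>y\<in>R. y * indicator (s -` {y}) x)"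
      unfolding E_def by (rule sum.reindex_bij_betw[OF h])
    also have "\<dots> = (\<Sum>y\<in>R. if s x = y then y else 0)"
      by (rule sum.cong) (auto simp: indicator_def)
    also have "\<dots> = s x" using R by (auto simp: R_def)
    finally show ?thesis by simp
  qed
  thus ?thesis unfolding has_simple_integral_def using E disj by blast
qed

text \<open>
  A Lebesgue measurable \<open>f\<close> is first replaced by a Borel function \<open>b\<close> that agrees with it off a null
  set and vanishes on that set, so that the support of \<open>b\<close> lies inside that of \<open>f\<close>. Borel simple
  functions tending to \<open>b\<close> and bounded by $2|b|$ keep this support, and dominated convergence makes
  them converge in $L^2$.
\<close>

lemma simple_approximation:
  assumes f: "f \<in> L1_L2" and supp: "{x. f x \<noteq> 0} \<in> lmeasurable"
  shows "\<exists>s v. (\<forall>n. has_simple_integral X (s n) (v n)) \<and> (\<forall>n x. s n x \<noteq> 0 \<longrightarrow> f x \<noteq> 0) \<and>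
    (\<lambda>n. L2_norm (\<lambda>x. s n x - f x)) \<longlonglongrightarrow> 0"
proof -
  have i: "integrable lebesgue f" "integrable lebesgue (\<lambda>x. (f x)\<^sup>2)"
    using f by (auto simp: L1_L2_def)
  note fm [measurable] = borel_measurable_integrable[OF i(1)]
  obtain f' where f' [measurable]: "f' \<in> borel_measurable lborel"
    and eq: "AE x in lborel. f x = f' x"
    using completion_ex_borel_measurable_real[OF fm] by blast
  obtain N where N: "N \<in> null_sets lborel" and sub: "{x \<in> space lborel. f x \<noteq> f' x} \<subseteq> N"
    using eq by (auto simp: eventually_ae_filter)
  have [measurable]: "N \<in> sets borel" using N by auto
  define b where "b x = (if x \<in> N then 0 else f' x)" for x
  have bm [measurable]: "b \<in> borel_measurable lborel" unfolding b_def by measurable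
  have b_eq: "b x = f x" if "x \<notin> N" for x using sub that
    by (cases "f x = f' x") (auto simp: b_def)
  have b_supp: "f x \<noteq> 0" if "b x \<noteq> 0" for x
    using that b_eq[of x] by (auto simp: b_def split: if_splits)
  obtain s where s: "\<And>n. simple_function lborel (s n)" "\<And>x. (\<lambda>n. s n x) \<longlonglongrightarrow> b x"
      "\<And>n x. \<bar>s n x\<bar> \<le> 2 * \<bar>b x\<bar>"
    using borel_measurable_implies_sequence_metric[OF bm, of 0] by (auto simp: dist_real_def)
  have s_supp: "f x \<noteq> 0" if "s n x \<noteq> 0" for n x
    using s(3)[of n x] that b_supp[of x] by auto
  have sm [measurable]: "s n \<in> borel_measurable borel" for n
    using borel_measurable_simple_function[OF s(1)] by simp
  have "\<exists>v. has_simple_integral X (s n) v" for n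
  proof (rule simple_function_has_simple_integral[OF s(1)])
    have "emeasure lborel {x. s n x \<noteq> 0} = emeasure lebesgue {x. s n x \<noteq> 0}" by simp
    also have "\<dots> \<le> emeasure lebesgue {x. f x \<noteq> 0}"
      using s_supp supp by (intro emeasure_mono) auto
    also have "\<dots> < \<infinity>"
      using fmeasurableD2[OF supp] by (simp only: infinity_ennreal_def less_top)
    finally show "emeasure lborel {x. s n x \<noteq> 0} < \<infinity>" .
  qed
  then obtain v where v: "\<And>n. has_simple_integral X (s n) (v n)" by metis
  have sml [measurable]: "s n \<in> borel_measurable lebesgue" for n
    using measurable_completion[of "s n" lborel borel] by simp
  have AE_N: "AE x in lebesgue. x \<notin> N"
    using AE_not_in[OF null_sets_completionI[OF N]] .
  have "(\<lambda>n. LINT x|lebesgue. (s n x - f x)\<^sup>2) \<longlonglongrightarrow> integral\<^sup>L lebesgue (\<lambda>_::real. 0::real)"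
  proof (rule integral_dominated_convergence[where w = "\<lambda>x. 9 * (f x)\<^sup>2"])
    show "AE x in lebesgue. (\<lambda>n. (s n x - f x)\<^sup>2) \<longlonglongrightarrow> 0"
      using AE_N
    proof eventually_elim
      case (elim x)
      have "(\<lambda>n. (s n x - f x)\<^sup>2) \<longlonglongrightarrow> (b x - f x)\<^sup>2" by (intro tendsto_intros s(2))
      thus ?case using b_eq[OF elim] by simp
    qed
    show "AE x in lebesgue. norm ((s n x - f x)\<^sup>2) \<le> 9 * (f x)\<^sup>2" for n
      using AE_N
    proof eventually_elim
      case (elim x)
      have "\<bar>s n x - f x\<bar> \<le> 3 * \<bar>f x\<bar>" using s(3)[of n x] b_eq[OF elim] by simp
      hence "\<bar>s n x - f x\<bar>\<^sup>2 \<le> (3 * \<bar>f x\<bar>)\<^sup>2" by (rule power_mono) simp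
      thus ?case by (simp add: power_mult_distrib)
    qed
  qed (use i in auto)
  hence "(\<lambda>n. sqrt (LINT x|lebesgue. (s n x - f x)\<^sup>2)) \<longlonglongrightarrow> sqrt 0"
    by (intro tendsto_real_sqrt) simp
  hence "(\<lambda>n. L2_norm (\<lambda>x. s n x - f x)) \<longlonglongrightarrow> 0" by (simp add: L2_norm_def)
  thus ?thesis using v s_supp by blast
qed

section \<open>The second moment of the integral of a simple function\<close>

lemma has_integral_indicator_finite_borel:
  "E \<in> finite_borel \<Longrightarrow> has_bochner_integral lebesgue (indicator E) (measure lborel E)"
  using has_bochner_integral_real_indicator[of E lebesgue] by (simp add: finite_borel_def)

text \<open>
  Overlapping sets are allowed so that a difference of two simple functions is again of this form,
  without passing to a common refinement.
\<close>

lemma indicator_combination_integrals: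
  fixes c :: "'i \<Rightarrow> real" and E :: "'i \<Rightarrow> real set"
  assumes E: "\<And>i. i \<in> I \<Longrightarrow> E i \<in> finite_borel"
  defines "s \<equiv> (\<lambda>x. \<Sum>i\<in>I. c i * indicator (E i) x)"
  shows "has_bochner_integral lebesgue s (\<Sum>i\<in>I. c i * measure lborel (E i))"
    and "has_bochner_integral lebesgue (\<lambda>x. (s x)\<^sup>2)
      (\<Sum>i\<in>I. \<Sum>j\<in>I. c i * c j * measure lborel (E i \<inter> E j))"
proof -
  show "has_bochner_integral lebesgue s (\<Sum>i\<in>I. c i * measure lborel (E i))"
    unfolding s_def
    by (intro has_bochner_integral_sum has_bochner_integral_mult_right
        has_integral_indicator_finite_borel E)
  have "E i \<inter> E j \<in> finite_borel" if "i \<in> I" "j \<in> I" for i j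
    using E[OF that(1)] E[OF that(2)] emeasure_mono[of "E i \<inter> E j" "E i" lborel]
    by (auto simp: finite_borel_def intro: le_less_trans)
  hence "has_bochner_integral lebesgue
      (\<lambda>x. \<Sum>i\<in>I. \<Sum>j\<in>I. c i * c j * indicator (E i \<inter> E j) x)
      (\<Sum>i\<in>I. \<Sum>j\<in>I. c i * c j * measure lborel (E i \<inter> E j))"
    by (intro has_bochner_integral_sum has_bochner_integral_mult_right
        has_integral_indicator_finite_borel)
  moreover have "(s x)\<^sup>2 = (\<Sum>i\<in>I. \<Sum>j\<in>I. c i * c j * indicator (E i \<inter> E j) x)" for x
    by (simp add: s_def power2_eq_square sum_product indicator_inter_arith mult_ac)
  ultimately show "has_bochner_integral lebesgue (\<lambda>x. (s x)\<^sup>2)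
      (\<Sum>i\<in>I. \<Sum>j\<in>I. c i * c j * measure lborel (E i \<inter> E j))" by simp
qed

lemma has_simple_integral_L1_L2:
  assumes "has_simple_integral X s v"
  shows "s \<in> L1_L2"
proof -
  obtain n c E where E: "\<forall>i<n::nat. E i \<in> finite_borel"
    and s: "s = (\<lambda>x. \<Sum>i<n. c i * indicator (E i) x)"
    using assms by (auto simp: has_simple_integral_def)
  show ?thesis
    using indicator_combination_integrals[of "{..<n}" E c] E
    by (auto simp: L1_L2_def s dest: integrable.intros)
qed

text \<open>
  The covariance $|E \cap F| + |E|\,|F|$ is the polar form of $\int s^2 + (\int s)^2$ on indicator
  functions, hence the identity for their linear combinations.
\<close>

lemma (in free_poisson_random_measure) trace_norm2_measure_combination:
  fixes c :: "'i \<Rightarrow> real" and E :: "'i \<Rightarrow> real set"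
  assumes E: "\<And>i. i \<in> I \<Longrightarrow> E i \<in> finite_borel"
  defines "s \<equiv> (\<lambda>x. \<Sum>i\<in>I. c i * indicator (E i) x)"
  shows "(trace_norm2 \<phi> (\<Sum>i\<in>I. c i *\<^sub>R X (E i)))\<^sup>2 =
    (LINT x|lebesgue. s x)\<^sup>2 + (LINT x|lebesgue. (s x)\<^sup>2)"
proof -
  have int: "has_bochner_integral lebesgue s (\<Sum>i\<in>I. c i * measure lborel (E i))"
    "has_bochner_integral lebesgue (\<lambda>x. (s x)\<^sup>2)
      (\<Sum>i\<in>I. \<Sum>j\<in>I. c i * c j * measure lborel (E i \<inter> E j))"
    unfolding s_def by (rule indicator_combination_integrals[OF E], assumption)+
  have "(trace_norm2 \<phi> (\<Sum>i\<in>I. c i *\<^sub>R X (E i)))\<^sup>2 =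
      Re (\<Sum>i\<in>I. \<Sum>j\<in>I. complex_of_real (c i * c j) * \<phi> (X (E i) o\<^sub>L X (E j)))"
    by (rule trace_norm2_real_combination) (intro self_adjoint E)
  also have "\<dots> = Re (\<Sum>i\<in>I. \<Sum>j\<in>I. complex_of_real (c i * c j *
      (measure lborel (E i \<inter> E j) + measure lborel (E i) * measure lborel (E j))))"
    by (intro arg_cong[of _ _ Re] sum.cong refl) (simp add: trace_measure_product E)
  also have "\<dots> = (\<Sum>i\<in>I. \<Sum>j\<in>I. c i * c j * measure lborel (E i \<inter> E j)) +
      (\<Sum>i\<in>I. \<Sum>j\<in>I. (c i * measure lborel (E i)) * (c j * measure lborel (E j)))"
    by (simp only: Re_sum Re_complex_of_real distrib_left sum.distrib mult_ac)
  also have "\<dots> = (LINT x|lebesgue. (s x)\<^sup>2) + (LINT x|lebesgue. s x)\<^sup>2"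
    unfolding has_bochner_integral_integral_eq[OF int(1)] has_bochner_integral_integral_eq[OF int(2)]
    by (simp add: power2_eq_square sum_product)
  finally show ?thesis by simp
qed

locale free_poisson_integration = free_poisson_random_measure A \<phi> X
  for A :: "'h::complex_hilbert op set" and \<phi> :: "'h op \<Rightarrow> complex" and X :: "real set \<Rightarrow> 'h op" +
  fixes \<iota> :: "'h op \<Rightarrow> 'l::complex_hilbert"
  assumes completion: "is_L2_completion A \<phi> \<iota>"
begin

lemma norm_completion_diff:
  assumes "v \<in> A" "w \<in> A"
  shows "norm (\<iota> v - \<iota> w) = trace_norm2 \<phi> (v - w)"
proof -
  have w': "op_scaleC (- 1) w = - w" using op_scaleC_of_real[of "- 1" w] by simp
  have w'': "- 1 *\<^sub>C \<iota> w = - \<iota> w" using scaleC_of_real[of "- 1" "\<iota> w"] by simp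
  have "- w \<in> A" using algebra_scaleC[OF assms(2), of "- 1"] w' by simp
  moreover have "\<iota> (- w) = - \<iota> w"
    using completion assms(2) w' w'' unfolding is_L2_completion_def by metis
  ultimately have "\<iota> (v - w) = \<iota> v - \<iota> w" "v - w \<in> A"
    using completion assms(1) algebra_add[of v "- w"] unfolding is_L2_completion_def
    by (metis add_uminus_conv_diff)+
  thus ?thesis using completion unfolding is_L2_completion_def by metis
qed

text \<open>
  In particular the integral of a simple function does not depend, up to $\|\cdot\|_2$, on the chosen
  representation: take $s = t$.
\<close>

lemma simple_integral_isometry:
  assumes s: "has_simple_integral X s v" and t: "has_simple_integral X t w"
  shows "(norm (\<iota> v - \<iota> w))\<^sup>2 =
    (LINT x|lebesgue. s x - t x)\<^sup>2 + (LINT x|lebesgue. (s x - t x)\<^sup>2)"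
proof -
  obtain n c E where E: "\<forall>i<n::nat. E i \<in> finite_borel"
    and s_eq: "s = (\<lambda>x. \<Sum>i<n. c i * indicator (E i) x)" and v: "v = (\<Sum>i<n. c i *\<^sub>R X (E i))"
    using s by (auto simp: has_simple_integral_def)
  obtain m d F where F: "\<forall>i<m::nat. F i \<in> finite_borel"
    and t_eq: "t = (\<lambda>x. \<Sum>i<m. d i * indicator (F i) x)" and w: "w = (\<Sum>i<m. d i *\<^sub>R X (F i))"
    using t by (auto simp: has_simple_integral_def)
  \<comment> \<open>The difference is one combination, indexed by the disjoint sum of the two index sets.\<close>
  define I where "I = {..<n} <+> {..<m}"
  define a where "a = case_sum c (\<lambda>i. - d i)"
  define G where "G = case_sum E F"
  have "v \<in> A" "w \<in> A"
    unfolding v w using E F by (auto intro!: algebra_sum algebra_scaleR measure_in_algebra)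
  moreover have "v - w = (\<Sum>i\<in>I. a i *\<^sub>R X (G i))"
    by (simp add: v w I_def a_def G_def sum.Plus sum_negf)
  moreover have "s x - t x = (\<Sum>i\<in>I. a i * indicator (G i) x)" for x
    unfolding s_eq t_eq I_def a_def G_def by (subst sum.Plus) (simp_all add: sum_negf)
  moreover have "G i \<in> finite_borel" if "i \<in> I" for i
    using that E F by (auto simp: I_def G_def)
  ultimately show ?thesis
    using trace_norm2_measure_combination[of I G a] by (simp add: norm_completion_diff)
qed

lemma simple_integral_dist_le:
  assumes "has_simple_integral X s v" "has_simple_integral X t w"
  shows "(norm (\<iota> v - \<iota> w))\<^sup>2 \<le> L1_L2_size (\<lambda>x. s x - t x)"
proof -
  have "\<bar>LINT x|lebesgue. s x - t x\<bar>\<^sup>2 \<le> (L1_norm (\<lambda>x. s x - t x))\<^sup>2"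
    unfolding L1_norm_def by (intro power_mono integral_abs_bound) simp
  thus ?thesis
    by (simp add: simple_integral_isometry[OF assms] L1_L2_size_def L2_norm_square)
qed

section \<open>Functions with support of finite measure\<close>

text \<open>
  The common support of finite measure upgrades $L^2$ convergence to convergence in $L^1$ as well,
  which controls the term $(\int s)^2$ of the second moment.
\<close>

lemma approximating_sequence_size_tendsto:
  assumes f: "f \<in> L1_L2" and supp: "{x. f x \<noteq> 0} \<in> lmeasurable"
    and s: "\<And>n. has_simple_integral X (s n) (v n)" "\<And>n x. s n x \<noteq> 0 \<Longrightarrow> f x \<noteq> 0"
      "(\<lambda>n. L2_norm (\<lambda>x. s n x - f x)) \<longlonglongrightarrow> 0"
  shows "(\<lambda>n. L1_L2_size (\<lambda>x. s n x - f x)) \<longlonglongrightarrow> 0"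
proof (rule tendsto_sandwich[OF _ _ tendsto_const])
  define C where "C = 1 + measure lebesgue {x. f x \<noteq> 0}"
  have "(L1_norm (\<lambda>x. s n x - f x))\<^sup>2 \<le> C * (L2_norm (\<lambda>x. s n x - f x))\<^sup>2" for n
    unfolding C_def
  proof (rule L1_norm_le_L2_norm_of_finite_support[OF _ supp])
    show "(\<lambda>x. s n x - f x) \<in> L1_L2"
      by (rule L1_L2_diff(1)[OF has_simple_integral_L1_L2[OF s(1)] f])
    show "x \<in> {x. f x \<noteq> 0}" if "s n x - f x \<noteq> 0" for x
      using that s(2)[of n x] by auto
  qed
  thus "\<forall>\<^sub>F n in sequentially.
      L1_L2_size (\<lambda>x. s n x - f x) \<le> (C + 1) * (L2_norm (\<lambda>x. s n x - f x))\<^sup>2"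
    by (simp add: L1_L2_size_def algebra_simps)
  have "(\<lambda>n. (C + 1) * (L2_norm (\<lambda>x. s n x - f x))\<^sup>2) \<longlonglongrightarrow> (C + 1) * 0\<^sup>2"
    by (intro tendsto_intros s(3))
  thus "(\<lambda>n. (C + 1) * (L2_norm (\<lambda>x. s n x - f x))\<^sup>2) \<longlonglongrightarrow> 0" by simp
qed (simp add: L1_L2_size_nonneg)

text \<open>
  This shows that the definite description in \<open>integral_finite_support\<close> denotes: there is an
  approximating sequence, its integrals form a Cauchy sequence, and those of any other approximating
  sequence have the same limit because the distance between the two tends to zero.
\<close>

lemma integral_finite_support_approximation:
  assumes f: "f \<in> L1_L2" and supp: "{x. f x \<noteq> 0} \<in> lmeasurable"
  obtains s v where "\<And>n. has_simple_integral X (s n) (v n)"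
    and "(\<lambda>n. L1_L2_size (\<lambda>x. s n x - f x)) \<longlonglongrightarrow> 0"
    and "(\<lambda>n. \<iota> (v n)) \<longlonglongrightarrow> integral_finite_support \<iota> X f"
proof -
  obtain s v where s: "\<And>n. has_simple_integral X (s n) (v n)" "\<And>n x. s n x \<noteq> 0 \<Longrightarrow> f x \<noteq> 0"
      "(\<lambda>n. L2_norm (\<lambda>x. s n x - f x)) \<longlonglongrightarrow> 0"
    using simple_approximation[OF f supp, of X] by blast
  have size0: "(\<lambda>n. L1_L2_size (\<lambda>x. s n x - f x)) \<longlonglongrightarrow> 0"
    by (rule approximating_sequence_size_tendsto[OF f supp s(1) _ s(3)]) (rule s(2))
  have dist_le: "(norm (\<iota> v' - \<iota> w'))\<^sup>2 \<le>
      2 * L1_L2_size (\<lambda>x. s' x - f x) + 2 * L1_L2_size (\<lambda>x. t' x - f x)"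
    if "has_simple_integral X s' v'" "has_simple_integral X t' w'" for s' v' t' w'
    using simple_integral_dist_le[OF that]
      L1_L2_size_triangle[OF that[THEN has_simple_integral_L1_L2] f] by linarith
  have "convergent (\<lambda>n. \<iota> (v n))"
    by (rule convergent_if_square_dist_le_errors[OF tendsto_mult_right_zero[OF size0, where c = 2]])
      (rule dist_le[OF s(1) s(1)])
  then obtain l where l: "(\<lambda>n. \<iota> (v n)) \<longlonglongrightarrow> l" by (auto simp: convergent_def)
  have "integral_finite_support \<iota> X f = l"
    unfolding integral_finite_support_def
  proof (rule the_equality, intro allI impI)
    fix s' v'
    assume s': "\<forall>n. has_simple_integral X (s' n) (v' n)" "\<forall>n x. s' n x \<noteq> 0 \<longrightarrow> f x \<noteq> 0"
      "(\<lambda>n. L2_norm (\<lambda>x. s' n x - f x)) \<longlonglongrightarrow> 0"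
    have size0': "(\<lambda>n. L1_L2_size (\<lambda>x. s' n x - f x)) \<longlonglongrightarrow> 0"
      by (rule approximating_sequence_size_tendsto[OF f supp s'(1)[rule_format] _ s'(3)])
        (use s'(2) in blast)
    have "(\<lambda>n. 2 * L1_L2_size (\<lambda>x. s' n x - f x) + 2 * L1_L2_size (\<lambda>x. s n x - f x)) \<longlonglongrightarrow> 0"
      using tendsto_add[OF tendsto_mult_right_zero[OF size0', where c = 2]
          tendsto_mult_right_zero[OF size0, where c = 2]] by simp
    hence "(\<lambda>n. \<iota> (v' n) - \<iota> (v n)) \<longlonglongrightarrow> 0"
      by (rule tendsto_zero_if_square_norm_le[OF dist_le[OF s'(1)[rule_format] s(1)]])
    from tendsto_add[OF this l] show "(\<lambda>n. \<iota> (v' n)) \<longlonglongrightarrow> l" by simp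
  next
    fix l'
    assume "\<forall>s v. (\<forall>n. has_simple_integral X (s n) (v n)) \<longrightarrow>
       (\<forall>n x. s n x \<noteq> 0 \<longrightarrow> f x \<noteq> 0) \<longrightarrow>
       (\<lambda>n. L2_norm (\<lambda>x. s n x - f x)) \<longlonglongrightarrow> 0 \<longrightarrow>
       (\<lambda>n. \<iota> (v n)) \<longlonglongrightarrow> l'"
    hence "(\<lambda>n. \<iota> (v n)) \<longlonglongrightarrow> l'" using s by blast
    thus "l' = l" using l by (rule LIMSEQ_unique)
  qed
  thus ?thesis using that[OF s(1) size0] l by simp
qed

lemma integral_finite_support_dist_le:
  assumes f: "f \<in> L1_L2" "{x. f x \<noteq> 0} \<in> lmeasurable"
    and g: "g \<in> L1_L2" "{x. g x \<noteq> 0} \<in> lmeasurable"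
  shows "(norm (integral_finite_support \<iota> X f - integral_finite_support \<iota> X g))\<^sup>2 \<le>
    4 * L1_L2_size (\<lambda>x. f x - g x)"
proof -
  obtain s v where s: "\<And>n. has_simple_integral X (s n) (v n)"
      "(\<lambda>n. L1_L2_size (\<lambda>x. s n x - f x)) \<longlonglongrightarrow> 0"
      "(\<lambda>n. \<iota> (v n)) \<longlonglongrightarrow> integral_finite_support \<iota> X f"
    by (rule integral_finite_support_approximation[OF f]) (rule that)
  obtain t w where t: "\<And>n. has_simple_integral X (t n) (w n)"
      "(\<lambda>n. L1_L2_size (\<lambda>x. t n x - g x)) \<longlonglongrightarrow> 0"
      "(\<lambda>n. \<iota> (w n)) \<longlonglongrightarrow> integral_finite_support \<iota> X g"
    by (rule integral_finite_support_approximation[OF g]) (rule that)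
  define D where "D = L1_L2_size (\<lambda>x. f x - g x)"
  have le: "(norm (\<iota> (v n) - \<iota> (w n)))\<^sup>2 \<le>
      2 * L1_L2_size (\<lambda>x. t n x - g x) * 2 + 2 * L1_L2_size (\<lambda>x. s n x - f x) + 4 * D" for n
  proof -
    note m = has_simple_integral_L1_L2[OF s(1)] has_simple_integral_L1_L2[OF t(1)]
    show ?thesis
      using simple_integral_dist_le[OF s(1) t(1), of n n]
        L1_L2_size_triangle[OF m(1)[of n] m(2)[of n] f(1)]
        L1_L2_size_triangle[OF m(2)[of n] f(1) g(1)]
      by (simp add: D_def)
  qed
  have "(\<lambda>n. (norm (\<iota> (v n) - \<iota> (w n)))\<^sup>2) \<longlonglongrightarrow>
      (norm (integral_finite_support \<iota> X f - integral_finite_support \<iota> X g))\<^sup>2"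
    by (intro tendsto_intros s(3) t(3))
  moreover have "(\<lambda>n. 2 * L1_L2_size (\<lambda>x. t n x - g x) * 2 +
      2 * L1_L2_size (\<lambda>x. s n x - f x) + 4 * D) \<longlonglongrightarrow> 2 * 0 * 2 + 2 * 0 + 4 * D"
    by (intro tendsto_intros s(2) t(2))
  ultimately have "(norm (integral_finite_support \<iota> X f - integral_finite_support \<iota> X g))\<^sup>2 \<le>
      2 * 0 * 2 + 2 * 0 + 4 * D"
    by (rule LIMSEQ_le) (use le in blast)
  thus ?thesis by (simp add: D_def)
qed

section \<open>Continuity of the integral\<close>

lemma truncation_support_lmeasurable:
  fixes f :: "real \<Rightarrow> real"
  assumes "f \<in> L1_L2"
  shows "{x. f x * indicator {-t..t} x \<noteq> 0} \<in> lmeasurable"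
proof (rule fmeasurableI2[of "{-t..t}"])
  define h where "h x = f x * indicator {-t..t} x" for x
  have "h \<in> L1_L2" unfolding h_def by (rule L1_L2_truncation(1)[OF assms]) simp
  hence [measurable]: "h \<in> borel_measurable lebesgue"
    by (simp add: L1_L2_def borel_measurable_integrable)
  have "{x \<in> space lebesgue. h x \<noteq> 0} \<in> sets lebesgue" by measurable
  thus "{x. f x * indicator {-t..t} x \<noteq> 0} \<in> sets lebesgue" by (simp add: h_def)
qed (auto simp: indicator_def)

text \<open>
  \<open>Lim\<close> is meaningful only once convergence is known. The integrals over $[-t, t]$ are Cauchy as
  $t \to \infty$ since the truncations of \<open>f\<close> converge in size; the limit is found along the natural
  numbers and then compared with every real \<open>t\<close>.
\<close>

lemma free_poisson_integral_tendsto: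
  assumes f: "f \<in> L1_L2"
  shows "((\<lambda>t. integral_finite_support \<iota> X (\<lambda>x. f x * indicator {-t..t} x)) \<longlongrightarrow>
    free_poisson_integral \<iota> X f) at_top"
proof -
  define J where "J = (\<lambda>t. integral_finite_support \<iota> X (\<lambda>x. f x * indicator {-t..t} x))"
  define q where "q t = 8 * L1_L2_size (\<lambda>x. f x * indicator {-t..t} x - f x)" for t
  have tr: "(\<lambda>x. f x * indicator {-t..t} x) \<in> L1_L2" for t
    by (rule L1_L2_truncation(1)[OF f]) simp
  have q0: "(q \<longlongrightarrow> 0) at_top"
    unfolding q_def by (rule tendsto_mult_right_zero[OF L1_L2_truncation_tendsto[OF f]])
  have dist_le: "(norm (J t - J r))\<^sup>2 \<le> q t + q r" for t r
    using integral_finite_support_dist_le[OF tr truncation_support_lmeasurable[OF f]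
        tr truncation_support_lmeasurable[OF f], of t r]
      L1_L2_size_triangle[OF tr[of t] tr[of r] f]
    by (simp add: J_def q_def)
  have qn: "(\<lambda>n. q (real n)) \<longlonglongrightarrow> 0"
    by (rule filterlim_compose[OF q0 filterlim_real_sequentially])
  have "convergent (\<lambda>n. J (real n))"
    by (rule convergent_if_square_dist_le_errors[OF qn]) (rule dist_le)
  then obtain l where l: "(\<lambda>n. J (real n)) \<longlonglongrightarrow> l" by (auto simp: convergent_def)
  have "(norm (J t - l))\<^sup>2 \<le> q t" for t
  proof -
    have "(\<lambda>n. (norm (J t - J (real n)))\<^sup>2) \<longlonglongrightarrow> (norm (J t - l))\<^sup>2"
      by (intro tendsto_intros l)
    moreover have "(\<lambda>n. q t + q (real n)) \<longlonglongrightarrow> q t + 0" by (intro tendsto_intros qn)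
    ultimately have "(norm (J t - l))\<^sup>2 \<le> q t + 0"
      by (rule LIMSEQ_le) (use dist_le in blast)
    thus ?thesis by simp
  qed
  hence "((\<lambda>t. J t - l) \<longlongrightarrow> 0) at_top"
    by (rule tendsto_zero_if_square_norm_le[OF _ q0])
  hence "(J \<longlongrightarrow> l) at_top" by (simp add: Lim_null[symmetric])
  moreover from this have "free_poisson_integral \<iota> X f = l"
    unfolding free_poisson_integral_def J_def by (intro tendsto_Lim) simp_all
  ultimately show ?thesis by (simp add: J_def)
qed

lemma free_poisson_integral_dist_le:
  assumes f: "f \<in> L1_L2" and g: "g \<in> L1_L2"
  shows "(norm (free_poisson_integral \<iota> X f - free_poisson_integral \<iota> X g))\<^sup>2 \<le>
    4 * L1_L2_size (\<lambda>x. f x - g x)"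
proof (rule tendsto_upperbound)
  show "((\<lambda>t. (norm (integral_finite_support \<iota> X (\<lambda>x. f x * indicator {-t..t} x) -
        integral_finite_support \<iota> X (\<lambda>x. g x * indicator {-t..t} x)))\<^sup>2) \<longlongrightarrow>
      (norm (free_poisson_integral \<iota> X f - free_poisson_integral \<iota> X g))\<^sup>2) (at_top :: real filter)"
    by (intro tendsto_intros free_poisson_integral_tendsto f g)
  show "\<forall>\<^sub>F t in (at_top :: real filter).
      (norm (integral_finite_support \<iota> X (\<lambda>x. f x * indicator {-t..t} x) -
        integral_finite_support \<iota> X (\<lambda>x. g x * indicator {-t..t} x)))\<^sup>2 \<le>
      4 * L1_L2_size (\<lambda>x. f x - g x)"
  proof (rule always_eventually, rule allI)
    fix t :: real
    have "(norm (integral_finite_support \<iota> X (\<lambda>x. f x * indicator {-t..t} x) -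
        integral_finite_support \<iota> X (\<lambda>x. g x * indicator {-t..t} x)))\<^sup>2 \<le>
        4 * L1_L2_size (\<lambda>x. f x * indicator {-t..t} x - g x * indicator {-t..t} x)"
      by (intro integral_finite_support_dist_le L1_L2_truncation(1) truncation_support_lmeasurable f g)
        simp_all
    also have "\<dots> \<le> 4 * L1_L2_size (\<lambda>x. f x - g x)"
      using L1_L2_truncation(2)[OF L1_L2_diff(1)[OF f g], of "{-t..t}"]
      by (simp add: left_diff_distrib)
    finally show "(norm (integral_finite_support \<iota> X (\<lambda>x. f x * indicator {-t..t} x) -
        integral_finite_support \<iota> X (\<lambda>x. g x * indicator {-t..t} x)))\<^sup>2 \<le>
      4 * L1_L2_size (\<lambda>x. f x - g x)" .
  qed
qed simp

end

theorem theorem5p5: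
  fixes A :: "'h::complex_hilbert op set"
    and \<phi> :: "'h op \<Rightarrow> complex"
    and X :: "real set \<Rightarrow> 'h op"
    and \<iota> :: "'h op \<Rightarrow> 'l::complex_hilbert"
    and f :: "nat \<Rightarrow> real \<Rightarrow> real"
    and g :: "real \<Rightarrow> real"
  assumes "free_poisson_random_measure A \<phi> X"
    and "is_L2_completion A \<phi> \<iota>"
    and "\<And>n. f n \<in> L1_L2"
    and "g \<in> L1_L2"
    and "(\<lambda>n. L1_norm (\<lambda>x. f n x - g x) + L2_norm (\<lambda>x. f n x - g x)) \<longlonglongrightarrow> 0"
  shows "(\<lambda>n. norm (free_poisson_integral \<iota> X (f n) - free_poisson_integral \<iota> X g)) \<longlonglongrightarrow> 0"
proof (rule tendsto_sandwich[OF _ _ tendsto_const])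
  interpret free_poisson_integration A \<phi> X \<iota>
    by (rule free_poisson_integration.intro[OF assms(1)
          free_poisson_integration_axioms.intro[OF assms(2)]])
  let ?e = "\<lambda>n. L1_norm (\<lambda>x. f n x - g x) + L2_norm (\<lambda>x. f n x - g x)"
  have "norm (free_poisson_integral \<iota> X (f n) - free_poisson_integral \<iota> X g) \<le> 2 * ?e n" for n
  proof (rule power2_le_imp_le)
    have nn: "0 \<le> L1_norm u" "0 \<le> L2_norm u" for u by (simp_all add: L1_norm_def L2_norm_def)
    have "L1_L2_size (\<lambda>x. f n x - g x) \<le> (?e n)\<^sup>2"
      unfolding L1_L2_size_def by (simp add: power2_sum nn)
    thus "(norm (free_poisson_integral \<iota> X (f n) - free_poisson_integral \<iota> X g))\<^sup>2 \<le> (2 * ?e n)\<^sup>2"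
      using free_poisson_integral_dist_le[OF assms(3,4), of n]
      unfolding power_mult_distrib by simp
    show "0 \<le> 2 * ?e n" by (simp add: nn)
  qed
  thus "\<forall>\<^sub>F n in sequentially.
      norm (free_poisson_integral \<iota> X (f n) - free_poisson_integral \<iota> X g) \<le> 2 * ?e n"
    by simp
  show "(\<lambda>n. 2 * ?e n) \<longlonglongrightarrow> 0" by (rule tendsto_mult_right_zero[OF assms(5)])
qed simp

end
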